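(* In either the good setting (with value functions $v_i:[k]^n\to\mathbb R_{>0}$) or the chore setting (with cost functions $c_i:[k]^n\to\mathbb R_{>0}$), an allocation rule $\mathbf x$ can be implemented truthfully if and only if $$\forall i\in[n],\ \forall \mathbf s_{-i}\in[k]^{n-1},\ \forall (s_i,s_i')\in\sigma_i(\mathbf s_{-i}),\qquad x_i(s_i,\mathbf s_{-i})\le x_i(s_i',\mathbf s_{-i}).$$
   Context: There are $n$ agents; $[\ell]=\{1,\dots,\ell\}$. Each agent $i\in[n]$ has a private signal $s_i\in[k]$; $\mathbf s=(s_1,\dots,s_n)$ and $\mathbf s_{-i}$ denotes all signals but the $i$-th. No monotonicity of the value or cost functions is assumed. An allocation rule is $\mathbf x=(x_i)_{i\in[n]}$ with $x_i:[k]^n\to[0,1]$ and $\sum_{i\in[n]}x_i(\mathbf s)=1$ for all $\mathbf s\in[k]^n$. Signal orders: in the good setting $\sigma_i(\mathbf s_{-i})=\{(s_i,s_i')\in[k]^2: v_i(s_i,\mathbf s_{-i})<v_i(s_i',\mathbf s_{-i})\}$; in the chore setting $\sigma_i(\mathbf s_{-i})=\{(s_i,s_i')\in[k]^2: c_i(s_i,\mathbf s_{-i})>c_i(s_i',\mathbf s_{-i})\}$. Given payment functions $p_i:[k]^n\to\mathbb R_{\ge0}$, $i\in[n]$, the utility of agent $i$ when the reported bids are $\mathbf b\in[k]^n$ and the true signals are $\mathbf s$ is $u_i(\mathbf b;\mathbf s)=x_i(\mathbf b)v_i(\mathbf s)-p_i(\mathbf b)$ (good) or $u_i(\mathbf b;\mathbf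 s)=p_i(\mathbf b)-x_i(\mathbf b)c_i(\mathbf s)$ (chore). The rule $\mathbf x$ can be implemented truthfully if there exist payment functions $(p_i)_{i\in[n]}$ such that for all $\mathbf s\in[k]^n$, $i\in[n]$, $b_i\in[k]$: $u_i(s_i,\mathbf s_{-i};\mathbf s)\ge u_i(b_i,\mathbf s_{-i};\mathbf s)$ (incentive compatibility) and $u_i(s_i,\mathbf s_{-i};\mathbf s)\ge0$ (individual rationality). *)

theory Defs
  imports Complex_Main "HOL-Library.FuncSet"
begin

(* Agents are 1..n and signals are 1..k. A profile in [k]^n is an extensional function on the
   agents; s_{-i} is an extensional function on the agents other than i, so that
   (a, s_{-i}) is t(i := a) and (b_i, s_{-i}) is s(i := b) for a full profile s. *)

type_synonym profile = "nat \<Rightarrow> nat"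

definition profiles :: "nat \<Rightarrow> nat \<Rightarrow> profile set" where
  "profiles n k = {1..n} \<rightarrow>\<^sub>E {1..k}"

definition profiles_without :: "nat \<Rightarrow> nat \<Rightarrow> nat \<Rightarrow> profile set" where
  "profiles_without n k i = ({1..n} - {i}) \<rightarrow>\<^sub>E {1..k}"

definition allocation_rule :: "nat \<Rightarrow> nat \<Rightarrow> (nat \<Rightarrow> profile \<Rightarrow> real) \<Rightarrow> bool" where
  "allocation_rule n k x \<longleftrightarrow>
     (\<forall>i\<in>{1..n}. \<forall>s\<in>profiles n k. x i s \<in> {0..1}) \<and>
     (\<forall>s\<in>profiles n k. (\<Sum>i\<in>{1..n}. x i s) = 1)"

definition signal_order_good ::
    "nat \<Rightarrow> (nat \<Rightarrow> profile \<Rightarrow> real) \<Rightarrow> nat \<Rightarrow> profile \<Rightarrow> (nat \<times> nat) set" where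
  "signal_order_good k v i t =
     {(a, a'). a \<in> {1..k} \<and> a' \<in> {1..k} \<and> v i (t(i := a)) < v i (t(i := a'))}"

definition signal_order_chore ::
    "nat \<Rightarrow> (nat \<Rightarrow> profile \<Rightarrow> real) \<Rightarrow> nat \<Rightarrow> profile \<Rightarrow> (nat \<times> nat) set" where
  "signal_order_chore k c i t =
     {(a, a'). a \<in> {1..k} \<and> a' \<in> {1..k} \<and> c i (t(i := a)) > c i (t(i := a'))}"

(* In both utilities, b is the profile of reported bids and s the profile of true signals. *)

definition utility_good ::
    "(nat \<Rightarrow> profile \<Rightarrow> real) \<Rightarrow> (nat \<Rightarrow> profile \<Rightarrow> real) \<Rightarrow> (nat \<Rightarrow> profile \<Rightarrow> real) \<Rightarrow>
      nat \<Rightarrow> profile \<Rightarrow> profile \<Rightarrow> real" where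
  "utility_good x v p i b s = x i b * v i s - p i b"

definition utility_chore ::
    "(nat \<Rightarrow> profile \<Rightarrow> real) \<Rightarrow> (nat \<Rightarrow> profile \<Rightarrow> real) \<Rightarrow> (nat \<Rightarrow> profile \<Rightarrow> real) \<Rightarrow>
      nat \<Rightarrow> profile \<Rightarrow> profile \<Rightarrow> real" where
  "utility_chore x c p i b s = p i b - x i b * c i s"

(* The argument u is the utility as a function of the payments, to be instantiated with
   "utility_good x v" or "utility_chore x c". The two inequalities are
   incentive compatibility and individual rationality. *)

definition truthfully_implementable ::
    "nat \<Rightarrow> nat \<Rightarrow> ((nat \<Rightarrow> profile \<Rightarrow> real) \<Rightarrow> nat \<Rightarrow> profile \<Rightarrow> profile \<Rightarrow> real) \<Rightarrow> bool" where
  "truthfully_implementable n k u \<longleftrightarrow>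
     (\<exists>p. (\<forall>i\<in>{1..n}. \<forall>s\<in>profiles n k. 0 \<le> p i s) \<and>
          (\<forall>s\<in>profiles n k. \<forall>i\<in>{1..n}. \<forall>b\<in>{1..k}.
             u p i s s \<ge> u p i (s(i := b)) s \<and> u p i s s \<ge> 0))"

end

theory Submission
  imports Defs
begin

text \<open>
  Truthfulness decouples over pairs \<^term>\<open>(i, t)\<close> of an agent and the other agents' signals,
  which leaves a one-dimensional screening problem with types \<^term>\<open>a\<close>, values \<^term>\<open>w a\<close> and
  allocations \<^term>\<open>y a\<close>. Adding the incentive constraints between two types gives monotonicity.
  Conversely, adding the types in order of \<^term>\<open>w a + y a\<close>, the largest payment
  of the new top type which deters it from imitating lower types also deters these from
  imitating it. Costs are treated as negative values, and a constant shift
  of the payments achieves individual rationality and nonnegativity.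
\<close>

text \<open>The hypothesis does not order \<open>y\<close> among types of equal \<open>w\<close>.
  Ranking by \<open>w a + y a\<close> breaks such ties by \<open>y\<close>, so that each added type
  is top in both coordinates among the types present.\<close>

lemma monotone_imp_incentive_compatible:
  fixes w y :: "'a \<Rightarrow> real"
  assumes "finite K" and "\<forall>a\<in>K. \<forall>b\<in>K. w a < w b \<longrightarrow> y a \<le> y b"
  shows "\<exists>q. \<forall>a\<in>K. \<forall>b\<in>K. y b * w a - q b \<le> y a * w a - q a"
  using assms
proof (induction K rule: finite_ranking_induct[where f = "\<lambda>a. w a + y a"])
  case empty
  then show ?case by simp
next
  case (insert m S)
  show ?case
  proof (cases "S = {} \<or> m \<in> S")
    case True
    then show ?thesis using insert by (auto simp: insert_absorb)
  next
    case False
    obtain q where q: "\<forall>a\<in>S. \<forall>b\<in>S. y b * w a - q b \<le> y a * w a - q a"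
      using insert.IH insert.prems by blast
    \<comment> \<open>At payment \<open>g b\<close>, type \<open>m\<close> is indifferent between
      its own allocation and imitating \<open>b\<close>. The minimum over \<open>S\<close> is
      therefore the largest payment that meets all constraints of \<open>m\<close>.\<close>
    define g where "g b = q b + (y m - y b) * w m" for b
    obtain b0 where b0: "b0 \<in> S" "\<And>b. b \<in> S \<Longrightarrow> g b0 \<le> g b"
      using ex_is_arg_min_if_finite[of S g] False insert.hyps(1)
      by (auto simp: is_arg_min_linorder)
    \<comment> \<open>Under monotonicity, the maximum of the sum is a maximum of both summands.\<close>
    have top: "w a \<le> w m \<and> y a \<le> y m" if "a \<in> S" for a
    proof -
      have "w m < w a \<longrightarrow> y m \<le> y a" "w a < w m \<longrightarrow> y a \<le> y m" "w a + y a \<le> w m + y m"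
        using that insert.prems insert.hyps by auto
      then show ?thesis by linarith
    qed
    have up: "y b * w m - q b \<le> y m * w m - g b0" if "b \<in> S" for b
      using b0(2)[OF that] by (simp add: g_def algebra_simps)
    \<comment> \<open>Type \<open>a\<close> does not gain by imitating \<open>b0\<close>. Moving on
      from \<open>b0\<close> to \<open>m\<close> costs a further \<open>(y m - y b0) * w m\<close>,
      and to \<open>a\<close> the additional allocation is worth at most that much.\<close>
    have down: "y m * w a - g b0 \<le> y a * w a - q a" if "a \<in> S" for a
    proof -
      have "y b0 * w a - q b0 \<le> y a * w a - q a"
        using q that b0(1) by blast
      moreover have "(y m - y b0) * w a \<le> (y m - y b0) * w m"
        using top[OF that] top[OF b0(1)] by (intro mult_left_mono) auto
      ultimately show ?thesis by (simp add: g_def algebra_simps)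
    qed
    have "\<forall>a\<in>insert m S. \<forall>b\<in>insert m S.
        y b * w a - (q(m := g b0)) b \<le> y a * w a - (q(m := g b0)) a"
      using False q up down by auto
    then show ?thesis by blast
  qed
qed

text \<open>The payments cancel in the sum of the two constraints, which leaves a product of
  differences with one positive factor.\<close>

lemma incentive_compatible_imp_monotone:
  fixes w y q :: "'a \<Rightarrow> real"
  assumes "y b * w a - q b \<le> y a * w a - q a" and "y a * w b - q a \<le> y b * w b - q b"
    and "w a < w b"
  shows "y a \<le> y b"
proof -
  have "0 \<le> (y b - y a) * (w b - w a)"
    using assms(1,2) by (simp add: algebra_simps)
  then show ?thesis
    using assms(3) by (simp add: zero_le_mult_iff)
qed

text \<open>A constant shift of the payments preserves incentive compatibility. Shifting the
  smallest payment to zero keeps all payments nonnegative and makes imitating the cheapest type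
  free, so every type can secure nonnegative utility.\<close>

lemma single_agent_good:
  fixes w y :: "'a \<Rightarrow> real"
  assumes "finite K" and "\<forall>a\<in>K. 0 < w a" and "\<forall>a\<in>K. 0 \<le> y a"
  shows "(\<exists>q. \<forall>a\<in>K. 0 \<le> q a \<and>
            (\<forall>b\<in>K. y b * w a - q b \<le> y a * w a - q a \<and> 0 \<le> y a * w a - q a)) \<longleftrightarrow>
         (\<forall>a\<in>K. \<forall>b\<in>K. w a < w b \<longrightarrow> y a \<le> y b)" (is "?L \<longleftrightarrow> ?R")
proof
  assume ?L
  then show ?R using incentive_compatible_imp_monotone by metis
next
  assume ?R
  then obtain q where q: "\<forall>a\<in>K. \<forall>b\<in>K. y b * w a - q b \<le> y a * w a - q a"
    using monotone_imp_incentive_compatible[OF assms(1)] by blast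
  show ?L
  proof (cases "K = {}")
    case False
    then obtain m where m: "m \<in> K" "\<And>b. b \<in> K \<Longrightarrow> q m \<le> q b"
      using ex_is_arg_min_if_finite[of K q] assms(1) by (auto simp: is_arg_min_linorder)
    have ir: "0 \<le> y a * w a - (q a - q m)" if "a \<in> K" for a
    proof -
      have "y m * w a - q m \<le> y a * w a - q a"
        using q that m(1) by blast
      moreover have "0 \<le> y m * w a"
        using assms that m(1) by (simp add: less_imp_le)
      ultimately show ?thesis by linarith
    qed
    show ?thesis
      by (rule exI[of _ "\<lambda>a. q a - q m"]) (use q m ir in auto)
  qed simp
qed

text \<open>With values \<open>- c a\<close> and payments of opposite sign this is the same
  screening problem. Here individual rationality already forces payments to be nonnegative, since
  they must cover a nonnegative cost, so only a large enough shift is needed.\<close>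

lemma single_agent_chore:
  fixes c y :: "'a \<Rightarrow> real"
  assumes "finite K" and "\<forall>a\<in>K. 0 < c a" and "\<forall>a\<in>K. 0 \<le> y a"
  shows "(\<exists>q. \<forall>a\<in>K. 0 \<le> q a \<and>
            (\<forall>b\<in>K. q b - y b * c a \<le> q a - y a * c a \<and> 0 \<le> q a - y a * c a)) \<longleftrightarrow>
         (\<forall>a\<in>K. \<forall>b\<in>K. c b < c a \<longrightarrow> y a \<le> y b)" (is "?L \<longleftrightarrow> ?R")
proof
  assume ?L
  then obtain q where "\<forall>a\<in>K. \<forall>b\<in>K. q b - y b * c a \<le> q a - y a * c a"
    by blast
  then show ?R
    using incentive_compatible_imp_monotone[of y _ "\<lambda>a. - c a" _ "\<lambda>a. - q a"] by fastforce
next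
  assume ?R
  then obtain q where q: "\<forall>a\<in>K. \<forall>b\<in>K. y b * (- c a) - q b \<le> y a * (- c a) - q a"
    using monotone_imp_incentive_compatible[OF assms(1), of "\<lambda>a. - c a" y] by auto
  \<comment> \<open>Individual rationality asks that \<open>C\<close> bound every
    \<open>q a + y a * c a\<close>. A sum of absolute values does so and also makes sense for empty
    \<open>K\<close>.\<close>
  define C where "C = (\<Sum>a\<in>K. \<bar>q a + y a * c a\<bar>)"
  have ir: "0 \<le> C - q a - y a * c a" if "a \<in> K" for a
    using member_le_sum[of a K "\<lambda>a. \<bar>q a + y a * c a\<bar>"] that assms(1)
    by (auto simp: C_def)
  have nonneg: "0 \<le> C - q a" if "a \<in> K" for a
  proof -
    have "0 \<le> y a * c a" using assms that by (simp add: less_imp_le)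
    then show ?thesis using ir[OF that] by linarith
  qed
  show ?L
    by (rule exI[of _ "\<lambda>a. C - q a"]) (use q ir nonneg in force)
qed

lemma fun_upd_in_profiles:
  assumes "i \<in> {1..n}" and "t \<in> profiles_without n k i" and "a \<in> {1..k}"
  shows "t(i := a) \<in> profiles n k"
  using assms by (auto simp: profiles_def profiles_without_def PiE_iff extensional_def)

lemma restrict_in_profiles_without:
  assumes "s \<in> profiles n k"
  shows "restrict s ({1..n} - {i}) \<in> profiles_without n k i"
  using assms by (auto simp: profiles_def profiles_without_def PiE_iff)

lemma restrict_fun_upd_self:
  assumes "i \<in> {1..n}" and "s \<in> profiles n k"
  shows "(restrict s ({1..n} - {i}))(i := b) = s(i := b)"
  using assms by (auto simp: profiles_def PiE_iff extensional_def fun_eq_iff)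

text \<open>Every constraint compares profiles that differ only in the report of one agent, so
  payments can be chosen separately for each pair \<open>(i, t)\<close> and glued together.
  \<open>G\<close> treats goods and chores at once, its last argument being the payment made or
  received.\<close>

lemma truthfully_implementable_iff_single_agent:
  assumes u: "\<And>p i b s. u p i b s = G i b s (p i b)"
  shows "truthfully_implementable n k u \<longleftrightarrow>
    (\<forall>i\<in>{1..n}. \<forall>t\<in>profiles_without n k i. \<exists>q. \<forall>a\<in>{1..k}. 0 \<le> q a \<and>
      (\<forall>b\<in>{1..k}. G i (t(i := b)) (t(i := a)) (q b) \<le> G i (t(i := a)) (t(i := a)) (q a) \<and>
        0 \<le> G i (t(i := a)) (t(i := a)) (q a)))"
    (is "_ \<longleftrightarrow> (\<forall>i\<in>_. \<forall>t\<in>_. \<exists>q. ?P i t q)")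
proof
  assume "truthfully_implementable n k u"
  then obtain p where p: "\<forall>i\<in>{1..n}. \<forall>s\<in>profiles n k. 0 \<le> p i s"
    "\<forall>s\<in>profiles n k. \<forall>i\<in>{1..n}. \<forall>b\<in>{1..k}.
      u p i (s(i := b)) s \<le> u p i s s \<and> 0 \<le> u p i s s"
    unfolding truthfully_implementable_def by blast
  have "\<exists>q. ?P i t q" if "i \<in> {1..n}" "t \<in> profiles_without n k i" for i t
  proof (rule exI[of _ "\<lambda>a. p i (t(i := a))"], rule ballI)
    fix a assume "a \<in> {1..k}"
    then have s: "t(i := a) \<in> profiles n k" using fun_upd_in_profiles that by blast
    show "0 \<le> p i (t(i := a)) \<and> (\<forall>b\<in>{1..k}.
        G i (t(i := b)) (t(i := a)) (p i (t(i := b)))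
          \<le> G i (t(i := a)) (t(i := a)) (p i (t(i := a))) \<and>
        0 \<le> G i (t(i := a)) (t(i := a)) (p i (t(i := a))))"
      using bspec[OF bspec[OF p(2) s] that(1)] p(1) s that(1) by (simp add: u)
  qed
  then show "\<forall>i\<in>{1..n}. \<forall>t\<in>profiles_without n k i. \<exists>q. ?P i t q" by blast
next
  assume "\<forall>i\<in>{1..n}. \<forall>t\<in>profiles_without n k i. \<exists>q. ?P i t q"
  then obtain q where q: "\<And>i t. i \<in> {1..n} \<Longrightarrow> t \<in> profiles_without n k i \<Longrightarrow> ?P i t (q i t)"
    by metis
  \<comment> \<open>Restricting \<open>s\<close> erases the report of agent \<open>i\<close>. A
    misreport by \<open>i\<close> thus selects another entry of the same schedule
    \<open>q i t\<close>, never another schedule.\<close>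
  define p where "p i s = q i (restrict s ({1..n} - {i})) (s i)" for i s
  have *: "0 \<le> p i s \<and>
      (\<forall>b\<in>{1..k}. u p i (s(i := b)) s \<le> u p i s s \<and> 0 \<le> u p i s s)"
    if i: "i \<in> {1..n}" and s: "s \<in> profiles n k" for i s
  proof -
    let ?t = "restrict s ({1..n} - {i})"
    have si: "s i \<in> {1..k}" using i s by (auto simp: profiles_def)
    have upd: "?t(i := b) = s(i := b)" for b
      using restrict_fun_upd_self[OF i s] .
    have p_upd: "p i (s(i := b)) = q i ?t b" for b
      unfolding p_def by (simp add: restrict_def if_distrib cong: if_cong)
    show ?thesis
      using bspec[OF q[OF i restrict_in_profiles_without[OF s]] si] p_upd[of "s i"]
      unfolding u upd p_upd fun_upd_triv by simp
  qed
  show "truthfully_implementable n k u"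
    unfolding truthfully_implementable_def using * by (intro exI[of _ p]) blast
qed

theorem lemma2p2:
  fixes n k :: nat and x :: "nat \<Rightarrow> profile \<Rightarrow> real"
  assumes "allocation_rule n k x"
  shows "(\<forall>v. (\<forall>i\<in>{1..n}. \<forall>s\<in>profiles n k. 0 < v i s) \<longrightarrow>
            (truthfully_implementable n k (utility_good x v) \<longleftrightarrow>
              (\<forall>i\<in>{1..n}. \<forall>t\<in>profiles_without n k i. \<forall>(a, a')\<in>signal_order_good k v i t.
                 x i (t(i := a)) \<le> x i (t(i := a'))))) \<and>
         (\<forall>c. (\<forall>i\<in>{1..n}. \<forall>s\<in>profiles n k. 0 < c i s) \<longrightarrow>
            (truthfully_implementable n k (utility_chore x c) \<longleftrightarrow>
              (\<forall>i\<in>{1..n}. \<forall>t\<in>profiles_without n k i. \<forall>(a, a')\<in>signal_order_chore k c i t.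
                 x i (t(i := a)) \<le> x i (t(i := a')))))"
proof (intro conjI allI impI)
  have x: "\<forall>a\<in>{1..k}. 0 \<le> x i (t(i := a))" if "i \<in> {1..n}" "t \<in> profiles_without n k i" for i t
    using assms fun_upd_in_profiles[OF that] that(1)
    unfolding allocation_rule_def by (meson atLeastAtMost_iff)
  {
    fix v :: "nat \<Rightarrow> profile \<Rightarrow> real"
    assume "\<forall>i\<in>{1..n}. \<forall>s\<in>profiles n k. 0 < v i s"
    then have pos: "\<forall>a\<in>{1..k}. 0 < v i (t(i := a))"
      if "i \<in> {1..n}" "t \<in> profiles_without n k i" for i t
      using fun_upd_in_profiles[OF that] that by blast
    show "truthfully_implementable n k (utility_good x v) \<longleftrightarrow>
        (\<forall>i\<in>{1..n}. \<forall>t\<in>profiles_without n k i. \<forall>(a, a')\<in>signal_order_good k v i t.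
           x i (t(i := a)) \<le> x i (t(i := a')))"
      \<comment> \<open>Both sides now quantify over the same pairs \<open>(i, t)\<close>, so it
        suffices to prove the equivalence for one pair.\<close>
      unfolding truthfully_implementable_iff_single_agent
        [of "utility_good x v" "\<lambda>i b s r. x i b * v i s - r", OF utility_good_def]
    proof (intro ball_cong refl)
      fix i t assume "i \<in> {1..n}" "t \<in> profiles_without n k i"
      from single_agent_good[OF finite_atLeastAtMost pos[OF this] x[OF this]]
      show "(\<exists>q. \<forall>a\<in>{1..k}. 0 \<le> q a \<and> (\<forall>b\<in>{1..k}.
            x i (t(i := b)) * v i (t(i := a)) - q b \<le> x i (t(i := a)) * v i (t(i := a)) - q a \<and>
            0 \<le> x i (t(i := a)) * v i (t(i := a)) - q a)) \<longleftrightarrow>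
          (\<forall>(a, a')\<in>signal_order_good k v i t. x i (t(i := a)) \<le> x i (t(i := a')))"
        unfolding signal_order_good_def by blast
    qed
  next
    fix c :: "nat \<Rightarrow> profile \<Rightarrow> real"
    assume "\<forall>i\<in>{1..n}. \<forall>s\<in>profiles n k. 0 < c i s"
    then have pos: "\<forall>a\<in>{1..k}. 0 < c i (t(i := a))"
      if "i \<in> {1..n}" "t \<in> profiles_without n k i" for i t
      using fun_upd_in_profiles[OF that] that by blast
    show "truthfully_implementable n k (utility_chore x c) \<longleftrightarrow>
        (\<forall>i\<in>{1..n}. \<forall>t\<in>profiles_without n k i. \<forall>(a, a')\<in>signal_order_chore k c i t.
           x i (t(i := a)) \<le> x i (t(i := a')))"
      unfolding truthfully_implementable_iff_single_agent
        [of "utility_chore x c" "\<lambda>i b s r. r - x i b * c i s", OF utility_chore_def]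
    proof (intro ball_cong refl)
      fix i t assume "i \<in> {1..n}" "t \<in> profiles_without n k i"
      \<comment> \<open>A pair in the chore order goes from higher to lower cost, which is the
        direction \<open>c b < c a\<close> of the single-agent condition.\<close>
      from single_agent_chore[OF finite_atLeastAtMost pos[OF this] x[OF this]]
      show "(\<exists>q. \<forall>a\<in>{1..k}. 0 \<le> q a \<and> (\<forall>b\<in>{1..k}.
            q b - x i (t(i := b)) * c i (t(i := a)) \<le> q a - x i (t(i := a)) * c i (t(i := a)) \<and>
            0 \<le> q a - x i (t(i := a)) * c i (t(i := a)))) \<longleftrightarrow>
          (\<forall>(a, a')\<in>signal_order_chore k c i t. x i (t(i := a)) \<le> x i (t(i := a')))"
        unfolding signal_order_chore_def by blast
    qed
  }
qed

end
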